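(* Let $n\ge 1$ and $k\ge 1$ be integers with $k\le n/2$. (i) Let $D\subseteq F_2^n$ be an antipodal $(2k+1)$-design. Let $C\subseteq F_2^n$ be formed by choosing, from each pair $\{x,-x\}$ of antipodal points of $D$, exactly one of the points $x$, $-x$. Then $C$ is a $(k,k)$-design. (ii) Conversely, if $C\subseteq F_2^n$ is a $(k,k)$-design which contains no pair of antipodal points (i.e., there is no $x$ with both $x\in C$ and $-x\in C$), then $D=C\cup(-C)$ is an antipodal $(2k+1)$-design in $F_2^n$.
   Context: $F_2^n$ is the set of binary vectors of length $n$ over $\{0,1\}$, with Hamming distance $d(x,y)$ (number of coordinates where $x,y$ differ). Define the "inner product" $\langle x,y\rangle:=1-\frac{2d(x,y)}{n}$. The Krawtchouk polynomials $Q_i^{(n)}(t)$, $i=0,\dots,n$, are defined by $Q_0^{(n)}(t)=1$, $Q_1^{(n)}(t)=t$ and $ntQ_i^{(n)}(t)=(n-i)Q_{i+1}^{(n)}(t)+iQ_{i-1}^{(n)}(t)$ for $i=1,\dots,n-1$. A code is a nonempty subset $C\subseteq F_2^n$; its moments are $M_i(C):=\sum_{x,y\in C}Q_i^{(n)}(\langle x,y\rangle)$ (sum over all ordered pairs, including $x=y$), $i=1,\dots,n$; these are always $\ge 0$. For $1\le m\le n$, $C$ is an $m$-design if $M_i(C)=0$ for all $i=1,\dots,m$; equivalently, in the matrix whose rows are the codewords, any $m$ columns contain every $m$-tuple of $\{0,1\}^m$ equally often (a binary orthogonal array of strength $m$). For a positive integer $k\le n/2$, $C$ is a $(k,k)$-design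 if $M_i(C)=0$ for all $i\in\{2,4,\dots,2k\}$. For $x\in F_2^n$, $-x$ denotes the unique point with $d(x,-x)=n$ (the complement of $x$), and $-C=\{-x:x\in C\}$. A code $C$ is antipodal if $x\in C$ implies $-x\in C$.
   Formalization: When n = 2k, a "(2k+1)-design" is not defined, since designs of strength m need m ≤ n; here it is taken to mean that all existing moments M_1, ..., M_n vanish. For n ≥ 2k+1 the statement is unchanged. *)

theory Defs
  imports Complex_Main "HOL-Library.Z2" "HOL-Computational_Algebra.Polynomial"
begin

definition F2 :: "nat \<Rightarrow> bit list set" where
  "F2 n = {x. length x = n}"

definition hamming_dist :: "bit list \<Rightarrow> bit list \<Rightarrow> nat" where
  "hamming_dist x y = card {i. i < length x \<and> x ! i \<noteq> y ! i}"

definition inner_prod :: "nat \<Rightarrow> bit list \<Rightarrow> bit list \<Rightarrow> real" where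
  "inner_prod n x y = 1 - 2 * real (hamming_dist x y) / real n"

text \<open>The three-term recurrence
  \<open>n t Q\<^sub>i(t) = (n - i) Q\<^sub>i\<^sub>+\<^sub>1(t) + i Q\<^sub>i\<^sub>-\<^sub>1(t)\<close> for \<open>1 \<le> i \<le> n - 1\<close> is solved for
  \<open>Q\<^sub>i\<^sub>+\<^sub>1\<close>. The values with index greater than \<open>n\<close> have no meaning
  (the recurrence divides by zero there) and are never used below.\<close>

fun krawtchouk :: "nat \<Rightarrow> nat \<Rightarrow> real poly" where
  "krawtchouk n 0 = 1"
| "krawtchouk n (Suc 0) = [:0, 1:]"
| "krawtchouk n (Suc (Suc i)) =
     smult (1 / (real n - real (Suc i)))
       (smult (real n) ([:0, 1:] * krawtchouk n (Suc i)) - smult (real (Suc i)) (krawtchouk n i))"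

lemma krawtchouk_recurrence:
  assumes "1 \<le> i" and "i \<le> n - 1"
  shows "real n * t * poly (krawtchouk n i) t =
    (real n - real i) * poly (krawtchouk n (i + 1)) t + real i * poly (krawtchouk n (i - 1)) t"
proof -
  obtain j where i: "i = Suc j"
    using assms(1) by (cases i) auto
  have nz: "real n - real (Suc j) \<noteq> 0"
    using assms i by linarith
  have "(real n - real (Suc j)) * poly (krawtchouk n (Suc (Suc j))) t =
      real n * (t * poly (krawtchouk n (Suc j)) t) - real (Suc j) * poly (krawtchouk n j) t"
    using nz by (simp only: krawtchouk.simps(3) poly_smult poly_diff poly_mult poly_pCons poly_0) simp
  then show ?thesis
    unfolding i by (simp only: Suc_eq_plus1[symmetric] diff_Suc_1)
qed

definition code :: "nat \<Rightarrow> bit list set \<Rightarrow> bool" where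
  "code n C \<longleftrightarrow> C \<subseteq> F2 n \<and> C \<noteq> {}"

definition moment :: "nat \<Rightarrow> nat \<Rightarrow> bit list set \<Rightarrow> real" where
  "moment n i C = (\<Sum>(x, y) \<in> C \<times> C. poly (krawtchouk n i) (inner_prod n x y))"

text \<open>Moments exist only for \<open>1 \<le> i \<le> n\<close>, so the guard \<open>i \<le> n\<close> is redundant when
  \<open>m \<le> n\<close>. It matters only for \<open>m > n\<close>, where being an \<open>m\<close>-design means that all moments
  vanish; this gives a meaning to \<open>(2k + 1)\<close>-designs in the boundary case \<open>n = 2k\<close>.\<close>

definition is_design :: "nat \<Rightarrow> nat \<Rightarrow> bit list set \<Rightarrow> bool" where
  "is_design n m C \<longleftrightarrow>
     code n C \<and> 1 \<le> m \<and> (\<forall>i. 1 \<le> i \<and> i \<le> m \<and> i \<le> n \<longrightarrow> moment n i C = 0)"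

definition is_kk_design :: "nat \<Rightarrow> nat \<Rightarrow> bit list set \<Rightarrow> bool" where
  "is_kk_design n k C \<longleftrightarrow>
     code n C \<and> 1 \<le> k \<and> 2 * k \<le> n \<and> (\<forall>j\<in>{1..k}. moment n (2 * j) C = 0)"

text \<open>The point written \<open>-x\<close> in coding theory; it is not the additive inverse in
  \<open>F\<^sub>2\<^sup>n\<close>, which is \<open>x\<close> itself.\<close>

definition antipode :: "bit list \<Rightarrow> bit list" where
  "antipode x = map (\<lambda>b. b + 1) x"

lemma antipode_unique:
  assumes "x \<in> F2 n"
  shows "y \<in> F2 n \<and> hamming_dist x y = n \<longleftrightarrow> y = antipode x"
proof -
  have flip: "a \<noteq> b \<longleftrightarrow> b = a + 1" for a b :: bit
    by (cases a; cases b) auto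
  have len: "length x = n"
    using assms by (simp add: F2_def)
  have "hamming_dist x y = n \<longleftrightarrow> (\<forall>i<n. x ! i \<noteq> y ! i)"
  proof
    assume "hamming_dist x y = n"
    then have "card {i. i < n \<and> x ! i \<noteq> y ! i} = card {..<n}"
      by (simp add: hamming_dist_def len)
    then have "{i. i < n \<and> x ! i \<noteq> y ! i} = {..<n}"
      by (intro card_subset_eq) auto
    then show "\<forall>i<n. x ! i \<noteq> y ! i"
      by auto
  next
    assume "\<forall>i<n. x ! i \<noteq> y ! i"
    then have "{i. i < n \<and> x ! i \<noteq> y ! i} = {..<n}"
      by auto
    then show "hamming_dist x y = n"
      by (simp add: hamming_dist_def len)
  qed
  moreover have "y = antipode x \<longleftrightarrow> length y = n \<and> (\<forall>i<n. y ! i = x ! i + 1)"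
    by (auto simp only: antipode_def list_eq_iff_nth_eq length_map nth_map len)
  ultimately show ?thesis
    by (simp only: F2_def mem_Collect_eq flip)
qed

definition antipodal :: "bit list set \<Rightarrow> bool" where
  "antipodal C \<longleftrightarrow> (\<forall>x\<in>C. antipode x \<in> C)"

definition antipodal_selection :: "bit list set \<Rightarrow> bit list set \<Rightarrow> bool" where
  "antipodal_selection D C \<longleftrightarrow> C \<subseteq> D \<and> (\<forall>x\<in>D. \<exists>!y. y \<in> {x, antipode x} \<and> y \<in> C)"

end

theory Submission
  imports Defs
begin

text \<open>Negating one argument negates the inner product, and \<open>Q\<^sub>i\<close> has the parity of \<open>i\<close>. Hence, if
  \<open>D\<close> is the disjoint union of \<open>C\<close> and \<open>-C\<close>, the four blocks of the double sum give
  \<open>M\<^sub>i(D) = 2 (1 + (-1)\<^sup>i) M\<^sub>i(C)\<close>: the odd moments of \<open>D\<close> vanish and the even ones are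
  four times those of \<open>C\<close>.\<close>

text \<open>The recurrence multiplies by \<open>t\<close> or goes back two indices, so parity
  propagates. The scalar in front is common to both sides, so even its default value 0 at
  \<open>Suc i = n\<close> does no harm.\<close>

lemma poly_krawtchouk_uminus:
  "poly (krawtchouk n i) (- t) = (-1) ^ i * poly (krawtchouk n i) t"
  by (induction n i rule: krawtchouk.induct) (simp_all add: algebra_simps)

lemma finite_F2: "finite (F2 n)"
proof -
  have "finite (UNIV :: bit set)"
    by (rule finite_subset[of _ "{0, 1}"]) (auto intro: bit.exhaust)
  then show ?thesis
    using finite_lists_length_eq[of "UNIV :: bit set" n] by (simp add: F2_def)
qed

lemma antipode_in_F2 [simp]: "antipode x \<in> F2 n \<longleftrightarrow> x \<in> F2 n"
  by (simp add: F2_def antipode_def)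

lemma antipode_antipode [simp]: "antipode (antipode x) = x"
proof -
  have "b + 1 + 1 = b" for b :: bit
    by (cases b) auto
  then show ?thesis
    by (simp only: antipode_def map_map comp_def map_ident)
qed

lemma inj_antipode: "inj antipode"
  by (rule inj_on_inverseI[of _ antipode]) simp

lemma antipode_neq:
  assumes "x \<in> F2 n" and "n \<ge> 1"
  shows "antipode x \<noteq> x"
  using assms by (cases x) (auto simp: F2_def antipode_def)

text \<open>The indices range over the length of the first argument, so symmetry rests on equal
  lengths.\<close>

lemma hamming_dist_commute:
  assumes "length x = length y"
  shows "hamming_dist x y = hamming_dist y x"
  unfolding hamming_dist_def by (rule arg_cong[where f = card]) (use assms in auto)

lemma inner_prod_commute:
  assumes "x \<in> F2 n" and "y \<in> F2 n"
  shows "inner_prod n x y = inner_prod n y x"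
  using assms by (simp add: inner_prod_def F2_def hamming_dist_commute)

text \<open>Flipping \<open>x\<close> swaps agreement and disagreement with \<open>y\<close>, and
  these two index sets partition the coordinates.\<close>

lemma hamming_dist_antipode_left:
  assumes "length x = length y"
  shows "hamming_dist (antipode x) y + hamming_dist x y = length x"
proof -
  have flip: "a + 1 \<noteq> b \<longleftrightarrow> a = b" for a b :: bit
    by (cases a; cases b) auto
  let ?E = "{i. i < length x \<and> x ! i = y ! i}" and ?N = "{i. i < length x \<and> x ! i \<noteq> y ! i}"
  have "hamming_dist (antipode x) y = card ?E"
    unfolding hamming_dist_def antipode_def
    by (rule arg_cong[where f = card]) (simp only: length_map nth_map flip cong: conj_cong)
  moreover have "card ?E + card ?N = card (?E \<union> ?N)"
    by (rule card_Un_disjoint[symmetric]) auto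
  moreover have "?E \<union> ?N = {..<length x}"
    by auto
  ultimately show ?thesis
    by (simp add: hamming_dist_def)
qed

text \<open>Replacing d by n - d turns 1 - 2d/n into its negative. At n = 0 division by zero would
  make both inner products 1.\<close>

lemma inner_prod_antipode_left:
  assumes "x \<in> F2 n" and "y \<in> F2 n" and "n \<ge> 1"
  shows "inner_prod n (antipode x) y = - inner_prod n x y"
proof -
  have "real (hamming_dist (antipode x) y) = real n - real (hamming_dist x y)"
    using hamming_dist_antipode_left[of x y] assms by (simp add: F2_def)
  then show ?thesis
    using assms(3) by (simp add: inner_prod_def diff_divide_distrib right_diff_distrib)
qed

lemma inner_prod_antipode_right:
  assumes "x \<in> F2 n" and "y \<in> F2 n" and "n \<ge> 1"
  shows "inner_prod n x (antipode y) = - inner_prod n x y"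
  using assms inner_prod_antipode_left[of y n x] by (simp add: inner_prod_commute[of x])

lemma moment_Un_antipode:
  assumes n: "n \<ge> 1" and C: "C \<subseteq> F2 n" and disj: "C \<inter> antipode ` C = {}"
  shows "moment n i (C \<union> antipode ` C) = 2 * (1 + (-1) ^ i) * moment n i C"
proof -
  let ?f = "\<lambda>x y. poly (krawtchouk n i) (inner_prod n x y)"
  have fin: "finite C"
    using C finite_F2 by (rule finite_subset)
  \<comment> \<open>Applied to the outer and the inner sum, this produces the four blocks.\<close>
  have split: "(\<Sum>x \<in> C \<union> antipode ` C. g x) = (\<Sum>x\<in>C. g x + g (antipode x))"
    for g :: "bit list \<Rightarrow> real"
    using fin disj
    by (simp add: sum.union_disjoint sum.distrib sum.reindex inj_on_subset[OF inj_antipode])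
  have mom: "moment n i A = (\<Sum>x\<in>A. \<Sum>y\<in>A. ?f x y)" for A
    by (simp add: moment_def sum.cartesian_product)
  have "moment n i (C \<union> antipode ` C) =
      (\<Sum>x\<in>C. \<Sum>y\<in>C. (?f x y + ?f x (antipode y)) +
        (?f (antipode x) y + ?f (antipode x) (antipode y)))"
    by (simp only: mom split sum.distrib)
  also have "\<dots> = (\<Sum>x\<in>C. \<Sum>y\<in>C. 2 * (1 + (-1) ^ i) * ?f x y)"
  proof (intro sum.cong refl)
    fix x y assume "x \<in> C" "y \<in> C"
    then have "x \<in> F2 n" "y \<in> F2 n"
      using C by auto
    \<comment> \<open>Each mixed block contributes a factor \<open>(-1) ^ i\<close>; in the last
      block the two negations cancel.\<close>
    then show "(?f x y + ?f x (antipode y)) + (?f (antipode x) y + ?f (antipode x) (antipode y))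
        = 2 * (1 + (-1) ^ i) * ?f x y"
      using n by (simp add: inner_prod_antipode_left inner_prod_antipode_right
          poly_krawtchouk_uminus algebra_simps)
  qed
  also have "\<dots> = 2 * (1 + (-1) ^ i) * moment n i C"
    by (simp only: mom sum_distrib_left)
  finally show ?thesis .
qed

lemma antipodal_Un_antipode: "antipodal (C \<union> antipode ` C)"
  by (auto simp: antipodal_def)

text \<open>Existence of a chosen point in each pair gives the covering of \<open>D\<close>,
  antipodality keeps \<open>-C\<close> inside \<open>D\<close>, and uniqueness gives
  disjointness.\<close>

lemma antipodal_selection_decompose:
  assumes n: "n \<ge> 1" and D: "D \<subseteq> F2 n" and anti: "antipodal D" and sel: "antipodal_selection D C"
  shows "D = C \<union> antipode ` C" and "C \<inter> antipode ` C = {}"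
proof -
  have CD: "C \<subseteq> D" and ex1: "\<And>x. x \<in> D \<Longrightarrow> \<exists>!y. y \<in> {x, antipode x} \<and> y \<in> C"
    using sel by (auto simp: antipodal_selection_def)
  show "D = C \<union> antipode ` C"
  proof
    show "D \<subseteq> C \<union> antipode ` C"
    proof
      fix x assume "x \<in> D"
      then have "x \<in> C \<or> antipode x \<in> C"
        using ex1 by blast
      then show "x \<in> C \<union> antipode ` C"
        by (metis Un_iff antipode_antipode imageI)
    qed
    show "C \<union> antipode ` C \<subseteq> D"
      using CD anti by (auto simp: antipodal_def)
  qed
  have "antipode x \<notin> C" if "x \<in> C" for x
  proof
    assume "antipode x \<in> C"
    moreover have "x \<in> D"
      using that CD by auto
    ultimately have "antipode x = x"
      using ex1[of x] that by blast
    then show False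
      using antipode_neq n D \<open>x \<in> D\<close> by blast
  qed
  then show "C \<inter> antipode ` C = {}"
    by auto
qed

theorem theorem2p3:
  fixes n k :: nat
  assumes "n \<ge> 1" and "k \<ge> 1" and "real k \<le> real n / 2"
  shows "(\<forall>D C. is_design n (2 * k + 1) D \<and> antipodal D \<and> antipodal_selection D C
             \<longrightarrow> is_kk_design n k C) \<and>
         (\<forall>C. is_kk_design n k C \<and> \<not> (\<exists>x. x \<in> C \<and> antipode x \<in> C)
             \<longrightarrow> is_design n (2 * k + 1) (C \<union> antipode ` C) \<and> antipodal (C \<union> antipode ` C))"
proof (intro conjI allI impI; (elim conjE)?)
  have kn: "2 * k \<le> n"
    using assms(3) by linarith
  fix D C
  assume des: "is_design n (2 * k + 1) D" and anti: "antipodal D" and sel: "antipodal_selection D C"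
  have D: "D \<subseteq> F2 n" "D \<noteq> {}"
    using des by (auto simp: is_design_def code_def)
  note dec = antipodal_selection_decompose[OF assms(1) D(1) anti sel]
  have C: "code n C"
    using D dec(1) by (auto simp: code_def)
  have "moment n (2 * j) C = 0" if "j \<in> {1..k}" for j
  proof -
    \<comment> \<open>The bound \<open>2 * k \<le> n\<close> discharges the guard on the index in
      \<open>is_design\<close>.\<close>
    have "moment n (2 * j) D = 0"
      using des that kn by (auto simp: is_design_def)
    \<comment> \<open>For an even index the factor is 4, which can be cancelled.\<close>
    then show ?thesis
      using moment_Un_antipode[OF assms(1) _ dec(2), of "2 * j"] C dec(1) by (simp add: code_def)
  qed
  then show "is_kk_design n k C"
    using C kn assms(2) by (simp add: is_kk_design_def)
next
  fix C
  assume des: "is_kk_design n k C" and "\<not> (\<exists>x. x \<in> C \<and> antipode x \<in> C)"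
  then have disj: "C \<inter> antipode ` C = {}"
    by auto
  have C: "C \<subseteq> F2 n" "C \<noteq> {}"
    using des by (auto simp: is_kk_design_def code_def)
  \<comment> \<open>The range reaches \<open>2 * k + 1\<close>, which exceeds \<open>n\<close> when
    n = 2k; this index is odd, so the factor \<open>1 + (-1) ^ i\<close> vanishes there too.\<close>
  have "moment n i (C \<union> antipode ` C) = 0" if i: "1 \<le> i" "i \<le> 2 * k + 1" for i
  proof (cases "even i")
    case True
    then obtain j where j: "i = 2 * j" ..
    \<comment> \<open>An even index at most \<open>2 * k + 1\<close> is at most
      \<open>2 * k\<close>.\<close>
    with i have "j \<in> {1..k}"
      by auto
    then show ?thesis
      using des j by (simp add: moment_Un_antipode[OF assms(1) C(1) disj] is_kk_design_def)
  next
    case False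
    then show ?thesis
      by (simp add: moment_Un_antipode[OF assms(1) C(1) disj])
  qed
  moreover have "code n (C \<union> antipode ` C)"
    using C by (auto simp: code_def)
  ultimately show "is_design n (2 * k + 1) (C \<union> antipode ` C)"
    by (simp add: is_design_def)
next
  show "antipodal (C \<union> antipode ` C)" for C
    by (rule antipodal_Un_antipode)
qed

end
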